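(* In dimension $3$, every possible Riemann curvature tensor occurs as the curvature tensor of a Hessian metric: for every algebraic curvature tensor $R$ on $\mathbb{R}^3$ with its standard inner product, there exist a Hessian metric $g$ on an open set $U\subset\mathbb{R}^3$, a point $p\in U$, and a linear isometry $(T_pU, g_p)\to\mathbb{R}^3$ carrying the Riemann curvature tensor of $g$ at $p$ to $R$.
   Context: A Riemannian metric $g$ is Hessian if around each point there are local coordinates $x$ and a function $\phi$ with $g_{ij} = \partial^2\phi/\partial x_i\partial x_j$. An algebraic curvature tensor on an inner product space $T$ is an element of $\Lambda^2T^*\otimes\Lambda^2T^*$ symmetric under exchanging the two pairs and satisfying the first Bianchi identity. *)

theory Defs
  imports "HOL-Analysis.Analysis"
begin

definition pd :: "'n::finite \<Rightarrow> (real^'n \<Rightarrow> real) \<Rightarrow> real^'n \<Rightarrow> real" where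
  "pd i f x = deriv (\<lambda>t. f (x + t *\<^sub>R axis i 1)) 0"

fun iter_pd :: "'n::finite list \<Rightarrow> (real^'n \<Rightarrow> real) \<Rightarrow> real^'n \<Rightarrow> real" where
  "iter_pd [] f = f"
| "iter_pd (i # is) f = pd i (iter_pd is f)"

definition smooth_on :: "(real^'n::finite) set \<Rightarrow> (real^'n \<Rightarrow> real) \<Rightarrow> bool" where
  "smooth_on U f \<longleftrightarrow>
     (\<forall>is. continuous_on U (iter_pd is f) \<and>
        (\<forall>x\<in>U. \<forall>i. (\<lambda>t. iter_pd is f (x + t *\<^sub>R axis i 1)) differentiable (at 0)))"

definition smooth_map_on :: "(real^'n::finite) set \<Rightarrow> (real^'n \<Rightarrow> real^'m::finite) \<Rightarrow> bool" where
  "smooth_map_on U F \<longleftrightarrow> (\<forall>k. smooth_on U (\<lambda>x. F x $ k))"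

definition riemannian_metric_on :: "(real^'n::finite) set \<Rightarrow> (real^'n \<Rightarrow> real^'n^'n) \<Rightarrow> bool" where
  "riemannian_metric_on U g \<longleftrightarrow> open U \<and>
     (\<forall>i j. smooth_on U (\<lambda>x. g x $ i $ j)) \<and>
     (\<forall>x\<in>U. transpose (g x) = g x \<and>
        (\<forall>v. v \<noteq> 0 \<longrightarrow> v \<bullet> (g x *v v) > 0))"

text \<open>Hessian metric: around each point there are local coordinates z (given by a
  diffeomorphism y from an open W onto an open neighbourhood V, y = inverse of the
  chart) and a smooth function phi with g_ab = d^2 phi / dz_a dz_b in these coordinates.\<close>
definition hessian_metric_on :: "(real^'n::finite) set \<Rightarrow> (real^'n \<Rightarrow> real^'n^'n) \<Rightarrow> bool" where
  "hessian_metric_on U g \<longleftrightarrow> riemannian_metric_on U g \<and>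
     (\<forall>q\<in>U. \<exists>V W y \<phi>. open V \<and> q \<in> V \<and> V \<subseteq> U \<and> open (W :: (real^'n) set) \<and>
        bij_betw y W V \<and> smooth_map_on W y \<and> smooth_map_on V (inv_into W y) \<and>
        smooth_on W \<phi> \<and>
        (\<forall>z\<in>W. \<forall>a b.
           (\<Sum>i\<in>UNIV. \<Sum>j\<in>UNIV. pd a (\<lambda>w. y w $ i) z * pd b (\<lambda>w. y w $ j) z * (g (y z) $ i $ j))
           = pd a (pd b \<phi>) z))"

text \<open>Christoffel symbols Gamma^k_ij and the Riemann curvature tensor.
  Convention: R(d_i,d_j)d_k = nabla_i nabla_j d_k - nabla_j nabla_i d_k = sum_l Rup l i j k d_l,
  and Rm i j k l = g(R(d_i,d_j)d_k, d_l).\<close>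
definition christoffel :: "(real^'n::finite \<Rightarrow> real^'n^'n) \<Rightarrow> 'n \<Rightarrow> 'n \<Rightarrow> 'n \<Rightarrow> real^'n \<Rightarrow> real" where
  "christoffel g k i j x = (1/2) * (\<Sum>l\<in>UNIV. matrix_inv (g x) $ k $ l *
      (pd i (\<lambda>y. g y $ j $ l) x + pd j (\<lambda>y. g y $ i $ l) x - pd l (\<lambda>y. g y $ i $ j) x))"

definition riemann_up :: "(real^'n::finite \<Rightarrow> real^'n^'n) \<Rightarrow> 'n \<Rightarrow> 'n \<Rightarrow> 'n \<Rightarrow> 'n \<Rightarrow> real^'n \<Rightarrow> real" where
  "riemann_up g l i j k x =
     pd i (christoffel g l j k) x - pd j (christoffel g l i k) x +
     (\<Sum>m\<in>UNIV. christoffel g l i m x * christoffel g m j k x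
               - christoffel g l j m x * christoffel g m i k x)"

definition riemann :: "(real^'n::finite \<Rightarrow> real^'n^'n) \<Rightarrow> real^'n \<Rightarrow> 'n \<Rightarrow> 'n \<Rightarrow> 'n \<Rightarrow> 'n \<Rightarrow> real" where
  "riemann g x i j k l = (\<Sum>m\<in>UNIV. riemann_up g m i j k x * g x $ m $ l)"

definition algebraic_curvature_tensor :: "('n::finite \<Rightarrow> 'n \<Rightarrow> 'n \<Rightarrow> 'n \<Rightarrow> real) \<Rightarrow> bool" where
  "algebraic_curvature_tensor R \<longleftrightarrow>
     (\<forall>i j k l. R i j k l = - R j i k l) \<and>
     (\<forall>i j k l. R i j k l = - R i j l k) \<and>
     (\<forall>i j k l. R i j k l = R k l i j) \<and>
     (\<forall>i j k l. R i j k l + R j k i l + R k i j l = 0)"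

definition tensor_form :: "('n::finite \<Rightarrow> 'n \<Rightarrow> 'n \<Rightarrow> 'n \<Rightarrow> real) \<Rightarrow> real^'n \<Rightarrow> real^'n \<Rightarrow> real^'n \<Rightarrow> real^'n \<Rightarrow> real" where
  "tensor_form R a b c d = (\<Sum>i\<in>UNIV. \<Sum>j\<in>UNIV. \<Sum>k\<in>UNIV. \<Sum>l\<in>UNIV.
      R i j k l * a $ i * b $ j * c $ k * d $ l)"

end

theory Submission
  imports Defs "HOL-Analysis.Cross3"
begin

text \<open>
  For a totally symmetric cubic form T, the potential |x|^2/2 + T(x,x,x)/6 has the Hessian
  g(x) = I + (T_ijk x^k), which is positive definite near 0. Fourth derivatives of a Hessian
  potential cancel in the curvature, and with (T_i)_jk = T_ijk one finds
  R_ijkl(0) = [T_i, T_j]_kl / 4. In dimension 3 a curvature tensor has the form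
  (a x b) . S (c x d) with S symmetric, and a rotation A acts by S -> A^T S A. A rotation in the
  12-plane achieves S_12 = 0; taking T_3 diagonal then makes the three commutator equations
  explicitly solvable, except when S is diagonal with S_11 distinct from S_22, and that case is
  removed by a further rotation through 45 degrees.
\<close>

unbundle cross3_syntax

subsection \<open>Hessian metrics of cubic potentials\<close>

text \<open>The two adjacent transpositions generate all permutations of the three slots.\<close>

definition symmetric_cubic :: "('n \<Rightarrow> 'n \<Rightarrow> 'n \<Rightarrow> real) \<Rightarrow> bool" where
  "symmetric_cubic T \<longleftrightarrow> (\<forall>i j k. T i j k = T j i k \<and> T i j k = T i k j)"

text \<open>For symmetric \<open>T\<close> this is a quarter of the commutator of the layers
  \<open>T i\<close> and \<open>T j\<close>. With \<open>l\<close> placed before \<open>m\<close>,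
  antisymmetry in \<open>k\<close>, \<open>l\<close> needs only commutativity of
  multiplication.\<close>

definition cubic_curvature ::
    "('n::finite \<Rightarrow> 'n \<Rightarrow> 'n \<Rightarrow> real) \<Rightarrow> 'n \<Rightarrow> 'n \<Rightarrow> 'n \<Rightarrow> 'n \<Rightarrow> real" where
  "cubic_curvature T i j k l =
     ((\<Sum>m\<in>UNIV. T i k m * T j l m) - (\<Sum>m\<in>UNIV. T j k m * T i l m)) / 4"

section \<open>Smoothness of polynomials and locality of iterated partial derivatives\<close>

lemma pd_eqI:
  "((\<lambda>t. f (x + t *\<^sub>R axis i 1)) has_real_derivative D) (at 0) \<Longrightarrow> pd i f x = D"
  unfolding pd_def by (rule DERIV_imp_deriv)

text \<open>Induction on the construction of \<open>f\<close>. That the derivative is again a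
  polynomial is what lets the result be iterated along \<open>iter_pd\<close>.\<close>

lemma real_polynomial_function_partial_derivative:
  fixes f :: "real^'n::finite \<Rightarrow> real"
  assumes "real_polynomial_function f"
  obtains f' where "real_polynomial_function f'"
    "\<And>x. ((\<lambda>t. f (x + t *\<^sub>R axis i 1)) has_real_derivative f' x) (at 0)"
proof -
  have "\<exists>f'. real_polynomial_function f' \<and>
      (\<forall>x. ((\<lambda>t. f (x + t *\<^sub>R axis i 1)) has_real_derivative f' x) (at 0))"
    using assms
  proof induction
    case (linear f)
    then interpret bounded_linear f .
    have "((\<lambda>t. f (x + t *\<^sub>R axis i 1)) has_real_derivative f (axis i 1)) (at 0)" for x
      unfolding add scale by (auto intro!: derivative_eq_intros)
    then show ?case
      by blast
  next
    case (const c)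
    then show ?case
      by (intro exI[of _ "\<lambda>x. 0"]) auto
  next
    case (add f g)
    then obtain f' g' where "real_polynomial_function f'" "real_polynomial_function g'"
      "\<And>x. ((\<lambda>t. f (x + t *\<^sub>R axis i 1)) has_real_derivative f' x) (at 0)"
      "\<And>x. ((\<lambda>t. g (x + t *\<^sub>R axis i 1)) has_real_derivative g' x) (at 0)"
      by blast
    then show ?case
      by (intro exI[of _ "\<lambda>x. f' x + g' x"]) (auto intro: DERIV_add)
  next
    case (mult f g)
    then obtain f' g' where "real_polynomial_function f'" "real_polynomial_function g'"
      and der: "\<And>x. ((\<lambda>t. f (x + t *\<^sub>R axis i 1)) has_real_derivative f' x) (at 0)"
      "\<And>x. ((\<lambda>t. g (x + t *\<^sub>R axis i 1)) has_real_derivative g' x) (at 0)"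
      by auto
    with mult.hyps have "real_polynomial_function (\<lambda>x. f' x * g x + g' x * f x)"
      by (intro real_polynomial_function.intros(2-))
    with DERIV_mult[OF der] show ?case
      by (intro exI[of _ "\<lambda>x. f' x * g x + g' x * f x"]) simp
  qed
  then show thesis
    using that by blast
qed

lemma real_polynomial_function_iter_pd:
  assumes "real_polynomial_function f"
  shows "real_polynomial_function (iter_pd is f)"
proof (induction "is")
  case Nil
  show ?case
    using assms by simp
next
  case (Cons i "is")
  then obtain f' where f': "real_polynomial_function f'"
    "\<And>x. ((\<lambda>t. iter_pd is f (x + t *\<^sub>R axis i 1)) has_real_derivative f' x) (at 0)"
    using real_polynomial_function_partial_derivative by metis
  then have "pd i (iter_pd is f) = f'"
    by (intro ext pd_eqI)
  with f'(1) show ?case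
    by simp
qed

lemma smooth_on_real_polynomial_function:
  assumes "real_polynomial_function f"
  shows "smooth_on U f"
  unfolding smooth_on_def
proof (intro allI conjI ballI)
  fix "is"
  have poly: "real_polynomial_function (iter_pd is f)"
    by (rule real_polynomial_function_iter_pd[OF assms])
  then show "continuous_on U (iter_pd is f)"
    using continuous_on_polymonial_function by (metis real_polynomial_function_eq)
  fix x i
  obtain f' where
    "\<And>x. ((\<lambda>t. iter_pd is f (x + t *\<^sub>R axis i 1)) has_real_derivative f' x) (at 0)"
    using real_polynomial_function_partial_derivative[OF poly] by metis
  then show "(\<lambda>t. iter_pd is f (x + t *\<^sub>R axis i 1)) differentiable at 0"
    using real_differentiable_def by blast
qed

lemma eventually_line_mem_open:
  fixes x :: "real^'n::finite"
  assumes "open U" "x \<in> U"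
  shows "\<forall>\<^sub>F t in nhds 0. x + t *\<^sub>R axis i 1 \<in> U"
proof -
  have "((\<lambda>t. x + t *\<^sub>R axis i 1) \<longlongrightarrow> x + 0 *\<^sub>R axis i 1) (nhds (0::real))"
    by (intro tendsto_intros filterlim_ident)
  then show ?thesis
    using assms by (simp add: topological_tendstoD)
qed

text \<open>A derivative at a point of an open set sees only values in that set, so arbitrary values
  outside \<open>U\<close> do no harm.\<close>

lemma iter_pd_cong:
  assumes "open U" "\<And>x. x \<in> U \<Longrightarrow> f x = g x" "x \<in> U"
  shows "iter_pd is f x = iter_pd is g x"
  using assms(3)
proof (induction "is" arbitrary: x)
  case Nil
  then show ?case
    using assms(2) by simp
next
  case (Cons i "is")
  have "\<forall>\<^sub>F t in nhds 0. iter_pd is f (x + t *\<^sub>R axis i 1) = iter_pd is g (x + t *\<^sub>R axis i 1)"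
    using eventually_line_mem_open[OF assms(1) Cons.prems] Cons.IH by (rule eventually_mono)
  then show ?case
    by (simp add: pd_def deriv_cong_ev)
qed

lemma smooth_on_cong:
  assumes "open U" "\<And>x. x \<in> U \<Longrightarrow> f x = g x" "smooth_on U g"
  shows "smooth_on U f"
  unfolding smooth_on_def
proof (intro allI conjI ballI)
  fix "is"
  note eq = iter_pd_cong[OF assms(1,2)]
  show "continuous_on U (iter_pd is f)"
  proof (rule continuous_on_eq)
    show "continuous_on U (iter_pd is g)"
      using assms(3) by (simp add: smooth_on_def)
  qed (simp add: eq)
  fix x i assume x: "x \<in> U"
  have "\<forall>\<^sub>F t in nhds 0. iter_pd is g (x + t *\<^sub>R axis i 1) = iter_pd is f (x + t *\<^sub>R axis i 1)"
    using eventually_line_mem_open[OF assms(1) x, of i] by eventually_elim (simp add: eq)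
  moreover obtain D where
    "((\<lambda>t. iter_pd is g (x + t *\<^sub>R axis i 1)) has_real_derivative D) (at 0)"
    using assms(3) x unfolding smooth_on_def by (meson real_differentiable_def)
  ultimately have "((\<lambda>t. iter_pd is f (x + t *\<^sub>R axis i 1)) has_real_derivative D) (at 0)"
    by (rule DERIV_cong_ev[OF refl _ refl, THEN iffD1])
  then show "(\<lambda>t. iter_pd is f (x + t *\<^sub>R axis i 1)) differentiable at 0"
    using real_differentiable_def by blast
qed

lemma real_polynomial_function_component:
  "real_polynomial_function (\<lambda>x::real^'n::finite. x $ i)"
  by (intro real_polynomial_function.intros(1) bounded_linear_vec_nth)

section \<open>The Hessian of a cubic potential as a metric near the origin\<close>

definition cubic_metric :: "('n::finite \<Rightarrow> 'n \<Rightarrow> 'n \<Rightarrow> real) \<Rightarrow> real^'n \<Rightarrow> real^'n^'n" where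
  "cubic_metric T x = mat 1 + (\<chi> i j. \<Sum>k\<in>UNIV. T i j k * x $ k)"

definition cubic_potential :: "('n::finite \<Rightarrow> 'n \<Rightarrow> 'n \<Rightarrow> real) \<Rightarrow> real^'n \<Rightarrow> real" where
  "cubic_potential T x = (\<Sum>i\<in>UNIV. (x $ i)\<^sup>2) / 2
     + (\<Sum>i\<in>UNIV. \<Sum>j\<in>UNIV. \<Sum>k\<in>UNIV. T i j k * x $ i * x $ j * x $ k) / 6"

lemma cubic_metric_nth:
  "cubic_metric T x $ i $ j = (if i = j then 1 else 0) + (\<Sum>k\<in>UNIV. T i j k * x $ k)"
  by (simp add: cubic_metric_def mat_def)

lemma cubic_metric_0 [simp]: "cubic_metric T 0 = mat 1"
  by (simp add: vec_eq_iff cubic_metric_nth mat_def)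

lemma cubic_metric_nth_has_derivative:
  "((\<lambda>t. cubic_metric T (x + t *\<^sub>R axis m 1) $ i $ j) has_real_derivative T i j m) (at t)"
proof -
  have "((\<lambda>t. \<Sum>k\<in>UNIV. T i j k * (x + t *\<^sub>R axis m 1) $ k) has_real_derivative
      (\<Sum>k\<in>UNIV. T i j k * (axis m 1 $ k))) (at t)"
    by (intro DERIV_sum) (auto intro!: derivative_eq_intros)
  then have "((\<lambda>t. \<Sum>k\<in>UNIV. T i j k * (x + t *\<^sub>R axis m 1) $ k) has_real_derivative
      T i j m) (at t)"
    by (simp add: axis_def if_distrib[of "\<lambda>a. _ * a"] cong: if_cong)
  from DERIV_add[OF DERIV_const this] show ?thesis
    unfolding cubic_metric_nth by simp
qed

lemma pd_cubic_metric: "pd m (\<lambda>y. cubic_metric T y $ i $ j) x = T i j m"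
  by (rule pd_eqI) (rule cubic_metric_nth_has_derivative)

lemma pd_cubic_potential:
  assumes "symmetric_cubic T"
  shows "pd i (cubic_potential T) x = x $ i + (\<Sum>j\<in>UNIV. \<Sum>k\<in>UNIV. T i j k * x $ j * x $ k) / 2"
proof -
  have sym: "T a b c = T b a c" "T a b c = T a c b" for a b c
    using assms unfolding symmetric_cubic_def by blast+
  define Q where "Q = (\<Sum>j\<in>UNIV. \<Sum>k\<in>UNIV. T i j k * x $ j * x $ k)"
  have d: "((\<lambda>t. (x + t *\<^sub>R axis i 1) $ a) has_real_derivative (if a = i then 1 else 0)) (at 0)" for a
    by (auto intro!: derivative_eq_intros simp: axis_def)
  have 1: "((\<lambda>t. (\<Sum>a\<in>UNIV. ((x + t *\<^sub>R axis i 1) $ a)\<^sup>2)) has_real_derivative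
      (\<Sum>a\<in>UNIV. if a = i then 2 * x $ a else 0)) (at 0)"
    by (rule DERIV_sum) (rule derivative_eq_intros d refl | simp)+
  have 2: "((\<lambda>t. T a b c * (x + t *\<^sub>R axis i 1) $ a * (x + t *\<^sub>R axis i 1) $ b * (x + t *\<^sub>R axis i 1) $ c)
     has_real_derivative ((if a = i then T a b c * x $ b * x $ c else 0)
       + (if b = i then T a b c * x $ a * x $ c else 0)
       + (if c = i then T a b c * x $ a * x $ b else 0))) (at 0)" for a b c
    by (rule derivative_eq_intros d refl)+ simp
  have 3: "((\<lambda>t. \<Sum>a\<in>UNIV. \<Sum>b\<in>UNIV. \<Sum>c\<in>UNIV.
      T a b c * (x + t *\<^sub>R axis i 1) $ a * (x + t *\<^sub>R axis i 1) $ b * (x + t *\<^sub>R axis i 1) $ c)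
     has_real_derivative (\<Sum>a\<in>UNIV. \<Sum>b\<in>UNIV. \<Sum>c\<in>UNIV.
        (if a = i then T a b c * x $ b * x $ c else 0)
       + (if b = i then T a b c * x $ a * x $ c else 0)
       + (if c = i then T a b c * x $ a * x $ b else 0))) (at 0)"
    by (intro DERIV_sum 2)
  \<comment> \<open>The product rule hits each of the three slots once. By symmetry of
    \<open>T\<close> each contributes the same \<open>Q\<close>, so the divisor 6 leaves
    \<open>Q / 2\<close>; \<open>A\<close>, \<open>B\<close>, \<open>C\<close> are the three
    slots.\<close>
  have A: "(\<Sum>a\<in>UNIV. \<Sum>b\<in>UNIV. \<Sum>c\<in>UNIV. if a = i then T a b c * x $ b * x $ c else 0) = Q"
  proof -
    have "(\<Sum>a\<in>UNIV. \<Sum>b\<in>UNIV. \<Sum>c\<in>UNIV. if a = i then T a b c * x $ b * x $ c else 0) =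
        (\<Sum>a\<in>UNIV. if a = i then \<Sum>b\<in>UNIV. \<Sum>c\<in>UNIV. T a b c * x $ b * x $ c else 0)"
      by (intro sum.cong) auto
    then show ?thesis
      by (simp add: Q_def)
  qed
  have B: "(\<Sum>a\<in>UNIV. \<Sum>b\<in>UNIV. \<Sum>c\<in>UNIV. if b = i then T a b c * x $ a * x $ c else 0) = Q"
  proof -
    have "(\<Sum>b\<in>UNIV. \<Sum>c\<in>UNIV. if b = i then T a b c * x $ a * x $ c else 0) =
        (\<Sum>b\<in>UNIV. if b = i then \<Sum>c\<in>UNIV. T a b c * x $ a * x $ c else 0)" for a
      by (intro sum.cong) auto
    then show ?thesis
      by (simp add: Q_def sym(1)[of _ i])
  qed
  have C: "(\<Sum>a\<in>UNIV. \<Sum>b\<in>UNIV. \<Sum>c\<in>UNIV. if c = i then T a b c * x $ a * x $ b else 0) = Q"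
    by (simp add: Q_def sym(2)[of _ _ i] sym(1)[of _ i])
  show ?thesis
    unfolding cubic_potential_def
    by (rule pd_eqI) (use DERIV_add[OF DERIV_cdivide[OF 1, of 2]
      DERIV_cdivide[OF 3[unfolded sum.distrib A B C], of 6]] in \<open>simp flip: Q_def\<close>)
qed

lemma pd_pd_cubic_potential:
  assumes "symmetric_cubic T"
  shows "pd i (pd j (cubic_potential T)) x = cubic_metric T x $ i $ j"
proof -
  have sym: "T a b c = T b a c" "T a b c = T a c b" for a b c
    using assms unfolding symmetric_cubic_def by blast+
  define Q where "Q = (\<Sum>k\<in>UNIV. T i j k * x $ k)"
  have d: "((\<lambda>t. (x + t *\<^sub>R axis i 1) $ a) has_real_derivative (if a = i then 1 else 0)) (at 0)" for a
    by (auto intro!: derivative_eq_intros simp: axis_def)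
  have 1: "((\<lambda>t. \<Sum>a\<in>UNIV. \<Sum>b\<in>UNIV. T j a b * (x + t *\<^sub>R axis i 1) $ a * (x + t *\<^sub>R axis i 1) $ b)
     has_real_derivative (\<Sum>a\<in>UNIV. \<Sum>b\<in>UNIV.
        (if a = i then T j a b * x $ b else 0) + (if b = i then T j a b * x $ a else 0))) (at 0)"
    by (intro DERIV_sum) (rule derivative_eq_intros d refl | simp)+
  \<comment> \<open>Again the two remaining slots contribute equally, which cancels the remaining
    divisor 2.\<close>
  have A: "(\<Sum>a\<in>UNIV. \<Sum>b\<in>UNIV. if a = i then T j a b * x $ b else 0) = Q"
    by (subst sum.swap) (simp add: Q_def sym(1)[of j])
  have B: "(\<Sum>a\<in>UNIV. \<Sum>b\<in>UNIV. if b = i then T j a b * x $ a else 0) = Q"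
    by (simp add: Q_def sym(1)[of j] sym(2)[of _ _ i])
  have "pd j (cubic_potential T) =
      (\<lambda>x. x $ j + (\<Sum>a\<in>UNIV. \<Sum>b\<in>UNIV. T j a b * x $ a * x $ b) / 2)"
    using pd_cubic_potential[OF assms] by blast
  moreover have "pd i (\<lambda>x. x $ j + (\<Sum>a\<in>UNIV. \<Sum>b\<in>UNIV. T j a b * x $ a * x $ b) / 2) x
      = (if j = i then 1 else 0) + (Q + Q) / 2"
    by (rule pd_eqI DERIV_add d DERIV_cdivide 1[unfolded sum.distrib A B])+
  ultimately show ?thesis
    by (simp add: cubic_metric_nth Q_def eq_commute)
qed

text \<open>Controls the deviation of \<open>cubic_metric T x\<close> from the identity: each
  component of a vector is at most its norm, so the triangle inequality gives the bound
  termwise.\<close>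

lemma quadratic_form_bound:
  fixes T :: "'n::finite \<Rightarrow> 'n \<Rightarrow> 'n \<Rightarrow> real"
  shows "\<bar>v \<bullet> ((\<chi> i j. \<Sum>k\<in>UNIV. T i j k * x $ k) *v v)\<bar>
    \<le> (\<Sum>i\<in>UNIV. \<Sum>j\<in>UNIV. \<Sum>k\<in>UNIV. \<bar>T i j k\<bar>) * norm x * (v \<bullet> v)"
proof -
  have "\<bar>T i j k * x $ k * v $ j * v $ i\<bar> \<le> \<bar>T i j k\<bar> * norm x * norm v * norm v" for i j k
    unfolding abs_mult by (intro mult_mono component_le_norm_cart) auto
  then have "(\<Sum>i\<in>UNIV. \<Sum>j\<in>UNIV. \<Sum>k\<in>UNIV. \<bar>T i j k * x $ k * v $ j * v $ i\<bar>)
      \<le> (\<Sum>i\<in>UNIV. \<Sum>j\<in>UNIV. \<Sum>k\<in>UNIV. \<bar>T i j k\<bar> * norm x * norm v * norm v)"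
    by (intro sum_mono)
  moreover have "\<bar>\<Sum>i\<in>UNIV. \<Sum>j\<in>UNIV. \<Sum>k\<in>UNIV. T i j k * x $ k * v $ j * v $ i\<bar>
      \<le> (\<Sum>i\<in>UNIV. \<Sum>j\<in>UNIV. \<Sum>k\<in>UNIV. \<bar>T i j k * x $ k * v $ j * v $ i\<bar>)"
    by (intro order_trans[OF sum_abs] sum_mono order_refl)
  ultimately show ?thesis
    by (simp add: inner_vec_def[of v] matrix_vector_mult_def sum_distrib_left sum_distrib_right
        dot_square_norm power2_eq_square mult_ac)
qed

text \<open>With \<open>C\<close> the sum of the absolute coefficients, the radius
  \<open>1 / (1 + C)\<close> gives \<open>C * norm x < 1\<close>, so the identity dominates the
  linear perturbation. The added 1 keeps the radius meaningful when \<open>T\<close>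
  vanishes.\<close>

definition cubic_ball :: "('n::finite \<Rightarrow> 'n \<Rightarrow> 'n \<Rightarrow> real) \<Rightarrow> (real^'n) set" where
  "cubic_ball T = ball 0 (1 / (1 + (\<Sum>i\<in>UNIV. \<Sum>j\<in>UNIV. \<Sum>k\<in>UNIV. \<bar>T i j k\<bar>)))"

lemma cubic_metric_pos:
  assumes "x \<in> cubic_ball T" "v \<noteq> 0"
  shows "v \<bullet> (cubic_metric T x *v v) > 0"
proof -
  define C where "C = (\<Sum>i\<in>UNIV. \<Sum>j\<in>UNIV. \<Sum>k\<in>UNIV. \<bar>T i j k\<bar>)"
  have "C \<ge> 0"
    unfolding C_def by (intro sum_nonneg) auto
  then have "(1 + C) * norm x < 1"
    using assms(1) by (simp add: cubic_ball_def field_simps flip: C_def)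
  then have "C * norm x < 1"
    using norm_ge_zero[of x] unfolding distrib_right by linarith
  then have "C * norm x * (v \<bullet> v) < v \<bullet> v"
    using assms(2) by simp
  with quadratic_form_bound[of v T x] show ?thesis
    by (simp add: cubic_metric_def matrix_vector_mult_add_rdistrib inner_add_right flip: C_def)
qed

lemma riemannian_metric_on_cubic_metric:
  assumes "symmetric_cubic T"
  shows "riemannian_metric_on (cubic_ball T) (cubic_metric T)"
  unfolding riemannian_metric_on_def
proof (intro conjI allI ballI impI)
  show "open (cubic_ball T)"
    by (simp add: cubic_ball_def)
  show "smooth_on (cubic_ball T) (\<lambda>x. cubic_metric T x $ i $ j)" for i j
    unfolding cubic_metric_nth
    by (intro smooth_on_real_polynomial_function real_polynomial_function.intros(2-)
        real_polynomial_function_sum real_polynomial_function_component) auto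
  show "transpose (cubic_metric T x) = cubic_metric T x" for x
    using assms by (simp add: transpose_def vec_eq_iff cubic_metric_nth symmetric_cubic_def)
qed (rule cubic_metric_pos)

text \<open>The standard coordinates serve around every point: the chart is the identity, with
  \<open>V\<close> and \<open>W\<close> both equal to the whole ball.\<close>

lemma hessian_metric_on_cubic_metric:
  fixes T :: "'n::finite \<Rightarrow> 'n \<Rightarrow> 'n \<Rightarrow> real"
  assumes "symmetric_cubic T"
  shows "hessian_metric_on (cubic_ball T) (cubic_metric T)"
proof -
  let ?U = "cubic_ball T"
  have U: "open ?U"
    by (simp add: cubic_ball_def)
  have id: "smooth_map_on ?U (\<lambda>x. x)"
    unfolding smooth_map_on_def
    by (intro allI smooth_on_real_polynomial_function real_polynomial_function_component)
  \<comment> \<open>\<open>inv_into\<close> is the identity only on the ball and unspecified outside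
    it, hence the transfer through \<open>smooth_on_cong\<close>.\<close>
  have inv: "smooth_map_on ?U (inv_into ?U (\<lambda>x. x))"
    unfolding smooth_map_on_def
  proof
    fix k
    show "smooth_on ?U (\<lambda>x. inv_into ?U (\<lambda>x. x) x $ k)"
      by (rule smooth_on_cong[OF U _ smooth_on_real_polynomial_function[OF real_polynomial_function_component[of k]]])
        (simp add: inv_into_f_f[of "\<lambda>x. x", simplified])
  qed
  have pot: "smooth_on ?U (cubic_potential T)"
    unfolding cubic_potential_def power2_eq_square
    by (intro smooth_on_real_polynomial_function real_polynomial_function.intros(2-)
        real_polynomial_function_divide
        real_polynomial_function_sum real_polynomial_function_component) auto
  have pd_id: "pd a (\<lambda>w. w $ i) z = (if i = a then 1 else 0)" for a i and z :: "real^'n"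
    by (rule pd_eqI) (auto intro!: derivative_eq_intros simp: axis_def)
  have hess: "(\<Sum>i\<in>UNIV. \<Sum>j\<in>UNIV. pd a (\<lambda>w. w $ i) z * pd b (\<lambda>w. w $ j) z *
      (cubic_metric T z $ i $ j)) = pd a (pd b (cubic_potential T)) z" for a b z
    by (simp add: pd_id pd_pd_cubic_potential[OF assms] if_distrib[of "\<lambda>a. a * _"]
        if_distrib[of "\<lambda>a. _ * a"] cong: if_cong)
  have "bij_betw (\<lambda>x. x) ?U ?U"
    by (simp add: bij_betw_def)
  with U id inv pot hess riemannian_metric_on_cubic_metric[OF assms] show ?thesis
    unfolding hessian_metric_on_def by blast
qed

section \<open>The derivative of the matrix inverse at the identity\<close>

lemma matrix_inv_cancel:
  fixes A :: "real^'n^'n"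
  assumes "invertible A"
  shows "A ** matrix_inv A = mat 1" "matrix_inv A ** A = mat 1"
  using someI_ex[OF assms[unfolded invertible_def]] by (simp_all add: matrix_inv_def)

lemma matrix_inv_mat_1: "matrix_inv (mat 1) = (mat 1 :: real^'n^'n)"
  using matrix_inv_cancel(1)[of "mat 1 :: real^'n^'n"] by (simp add: invertible_det_nz)

text \<open>Column \<open>l\<close> of the inverse solves \<open>A *v y = axis l 1\<close>, so
  Cramer's rule applies. A quotient of determinants makes differentiability of the inverse
  accessible.\<close>

lemma matrix_inv_nth:
  fixes A :: "real^'n::finite^'n"
  assumes "det A \<noteq> 0"
  shows "matrix_inv A $ k $ l =
    det (\<chi> i j. if j = k then (if i = l then 1 else 0) else A $ i $ j) / det A"
proof -
  have "A ** matrix_inv A = mat 1"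
    using matrix_inv_cancel(1) assms invertible_det_nz by blast
  then have "A *v column l (matrix_inv A) = axis l 1"
    by (metis matrix_vector_mul_assoc matrix_vector_mul_lid matrix_vector_mult_basis)
  then have "column l (matrix_inv A) =
      (\<chi> k. det (\<chi> i j. if j = k then axis l 1 $ i else A $ i $ j) / det A)"
    using cramer[OF assms] by blast
  then have "column l (matrix_inv A) $ k =
      det (\<chi> i j. if j = k then axis l 1 $ i else A $ i $ j) / det A"
    by simp
  then show ?thesis
    by (simp add: column_def axis_def eq_commute cong: if_cong)
qed

lemma differentiable_prod:
  fixes f :: "'a \<Rightarrow> real \<Rightarrow> real"
  assumes "\<And>i. i \<in> S \<Longrightarrow> f i differentiable at t"
  shows "(\<lambda>t. \<Prod>i\<in>S. f i t) differentiable at t"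
  using assms by (induction S rule: infinite_finite_induct) simp_all

lemma differentiable_det:
  fixes A :: "real \<Rightarrow> real^'n::finite^'n"
  assumes "\<And>i j. (\<lambda>t. A t $ i $ j) differentiable at t"
  shows "(\<lambda>t. det (A t)) differentiable at t"
  unfolding det_def using assms
  by (intro differentiable_sum differentiable_mult differentiable_prod differentiable_const ballI
      finite_permutations finite)

text \<open>Cramer's rule shows that some derivative \<open>D\<close> exists; differentiating the
  product of the inverse with \<open>A t\<close>, which is constantly the identity, then gives
  \<open>D + B = 0\<close>.\<close>

lemma matrix_inv_nth_has_derivative:
  fixes A :: "real \<Rightarrow> real^'n::finite^'n"
  assumes der: "\<And>i j. ((\<lambda>t. A t $ i $ j) has_real_derivative B $ i $ j) (at 0)"
    and A0: "A 0 = mat 1"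
  shows "((\<lambda>t. matrix_inv (A t) $ k $ l) has_real_derivative - B $ k $ l) (at 0)"
proof -
  have diff: "(\<lambda>t. A t $ i $ j) differentiable at 0" for i j
    using der real_differentiable_def by blast
  have det_diff: "(\<lambda>t. det (A t)) differentiable at 0"
    by (rule differentiable_det[OF diff])
  then have "isCont (\<lambda>t. det (A t)) 0"
    by (rule differentiable_imp_continuous_within)
  \<comment> \<open>By continuity \<open>A t\<close> stays invertible near 0. Both Cramer's formula
    and the cancellation law are available only there, which is enough for derivatives at 0.\<close>
  then have ev: "\<forall>\<^sub>F t in nhds 0. det (A t) \<noteq> 0"
    by (intro tendsto_imp_eventually_ne[where c = "det (A 0)"])
      (simp_all add: A0 isCont_def tendsto_nhds_iff)
  have "\<exists>D. ((\<lambda>t. matrix_inv (A t) $ k $ l) has_real_derivative D) (at 0)" for k l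
  proof -
    have "(\<lambda>t. det (\<chi> i j. if j = k then (if i = l then 1 else 0) else A t $ i $ j) / det (A t))
        differentiable at 0"
    proof (intro differentiable_divide det_diff differentiable_det)
      show "(\<lambda>t. (\<chi> i j. if j = k then (if i = l then 1 else 0) else A t $ i $ j) $ i $ j)
          differentiable at 0" for i j
        by (cases "j = k") (simp_all add: diff)
    qed (simp add: A0)
    then obtain D where "((\<lambda>t. det (\<chi> i j. if j = k then (if i = l then 1 else 0) else A t $ i $ j)
        / det (A t)) has_real_derivative D) (at 0)"
      using real_differentiable_def by blast
    moreover have "\<forall>\<^sub>F t in nhds 0. det (\<chi> i j. if j = k then (if i = l then 1 else 0) else A t $ i $ j)
        / det (A t) = matrix_inv (A t) $ k $ l"
      using ev by eventually_elim (simp add: matrix_inv_nth)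
    ultimately have "((\<lambda>t. matrix_inv (A t) $ k $ l) has_real_derivative D) (at 0)"
      by (rule DERIV_cong_ev[OF refl _ refl, THEN iffD1, rotated])
    then show ?thesis ..
  qed
  then obtain D where D: "\<And>k l. ((\<lambda>t. matrix_inv (A t) $ k $ l) has_real_derivative D k l) (at 0)"
    by metis
  have inv0: "matrix_inv (A 0) = mat 1"
    by (simp add: A0 matrix_inv_mat_1)
  have "((\<lambda>t. \<Sum>m\<in>UNIV. matrix_inv (A t) $ k $ m * A t $ m $ l) has_real_derivative
      (\<Sum>m\<in>UNIV. D k m * A 0 $ m $ l + B $ m $ l * matrix_inv (A 0) $ k $ m)) (at 0)"
    by (intro DERIV_sum DERIV_mult D der)
  also have "(\<Sum>m\<in>UNIV. D k m * A 0 $ m $ l + B $ m $ l * matrix_inv (A 0) $ k $ m)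
      = D k l + B $ k $ l"
    unfolding inv0 unfolding A0
    by (simp add: mat_def sum.distrib if_distrib[of "\<lambda>a. _ * a"] cong: if_cong)
  finally have 1: "((\<lambda>t. \<Sum>m\<in>UNIV. matrix_inv (A t) $ k $ m * A t $ m $ l) has_real_derivative
      D k l + B $ k $ l) (at 0)" .
  have "\<forall>\<^sub>F t in nhds 0. (\<Sum>m\<in>UNIV. matrix_inv (A t) $ k $ m * A t $ m $ l)
      = (mat 1 :: real^'n^'n) $ k $ l"
    using ev
  proof eventually_elim
    case (elim t)
    then have "matrix_inv (A t) ** A t = mat 1"
      using matrix_inv_cancel(2) invertible_det_nz by blast
    from arg_cong[OF this, of "\<lambda>M. M $ k $ l"] show ?case
      by (simp add: matrix_matrix_mult_def)
  qed
  \<comment> \<open>The same entry of the product is locally constant, so uniqueness of derivatives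
    forces \<open>D k l + B $ k $ l = 0\<close>.\<close>
  with 1 have "((\<lambda>t. (mat 1 :: real^'n^'n) $ k $ l) has_real_derivative D k l + B $ k $ l) (at 0)"
    by (rule DERIV_cong_ev[OF refl _ refl, THEN iffD1, rotated])
  then have "D k l = - B $ k $ l"
    using DERIV_unique[OF DERIV_const] by fastforce
  with D show ?thesis
    by metis
qed

section \<open>Christoffel symbols and curvature at the origin\<close>

lemma christoffel_cubic_metric:
  assumes "symmetric_cubic T"
  shows "christoffel (cubic_metric T) k i j x =
    (\<Sum>l\<in>UNIV. matrix_inv (cubic_metric T x) $ k $ l * T i j l) / 2"
proof -
  \<comment> \<open>The three first derivatives of the metric all equal \<open>T i j l\<close>; two
    of them cancel, leaving one.\<close>
  have "T j l i = T i j l" "T i l j = T i j l" for l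
    using assms unfolding symmetric_cubic_def by metis+
  then show ?thesis
    by (simp add: christoffel_def pd_cubic_metric)
qed

lemma christoffel_cubic_metric_0:
  fixes T :: "'n::finite \<Rightarrow> 'n \<Rightarrow> 'n \<Rightarrow> real"
  assumes "symmetric_cubic T"
  shows "christoffel (cubic_metric T) k i j 0 = T i j k / 2"
  unfolding christoffel_cubic_metric[OF assms] cubic_metric_0 matrix_inv_mat_1
  by (simp add: mat_def if_distrib[of "\<lambda>a. a * _"] cong: if_cong)

text \<open>The metric is affine in the coordinates, so the symbols with lowered index are the
  constants \<open>T i j l / 2\<close>. Only the inverse metric varies, and at the identity its
  derivative is minus that of the metric.\<close>

lemma pd_christoffel_cubic_metric_0:
  fixes T :: "'n::finite \<Rightarrow> 'n \<Rightarrow> 'n \<Rightarrow> real"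
  assumes "symmetric_cubic T"
  shows "pd m (christoffel (cubic_metric T) k i j) 0 = - (\<Sum>l\<in>UNIV. T k l m * T i j l) / 2"
proof (rule pd_eqI)
  let ?A = "\<lambda>t. cubic_metric T (0 + t *\<^sub>R axis m 1)"
  have "((\<lambda>t. matrix_inv (?A t) $ k $ l) has_real_derivative - (\<chi> i j. T i j m) $ k $ l) (at 0)" for l
    by (rule matrix_inv_nth_has_derivative) (use cubic_metric_nth_has_derivative[of T 0 m] in simp_all)
  then have "((\<lambda>t. matrix_inv (?A t) $ k $ l) has_real_derivative - T k l m) (at 0)" for l
    by simp
  then have "((\<lambda>t. (\<Sum>l\<in>UNIV. matrix_inv (?A t) $ k $ l * T i j l) / 2)
      has_real_derivative (\<Sum>l\<in>UNIV. - T k l m * T i j l) / 2) (at 0)"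
    by (intro DERIV_cdivide DERIV_sum DERIV_cmult_right)
  then show "((\<lambda>t. christoffel (cubic_metric T) k i j (0 + t *\<^sub>R axis m 1)) has_real_derivative
      - (\<Sum>l\<in>UNIV. T k l m * T i j l) / 2) (at 0)"
    unfolding christoffel_cubic_metric[OF assms] by (simp add: sum_negf)
qed

lemma riemann_cubic_metric_0:
  fixes T :: "'n::finite \<Rightarrow> 'n \<Rightarrow> 'n \<Rightarrow> real"
  assumes "symmetric_cubic T"
  shows "riemann (cubic_metric T) 0 i j k l = cubic_curvature T i j k l"
proof -
  have sym: "T a b c = T b a c" "T a b c = T a c b" for a b c
    using assms unfolding symmetric_cubic_def by blast+
  \<comment> \<open>\<open>P a b\<close> is the \<open>k\<close>, \<open>l\<close> entry of the
    product of the layers \<open>T a\<close> and \<open>T b\<close>.\<close>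
  define P where "P a b = (\<Sum>m\<in>UNIV. T a k m * T b l m)" for a b
  have 1: "(\<Sum>m\<in>UNIV. T l m a * T b k m) = P b a" for a b
    unfolding P_def by (rule sum.cong) (metis sym mult.commute)+
  have 2: "(\<Sum>m\<in>UNIV. T a m l / 2 * (T b k m / 2)) = P b a / 4" for a b
    unfolding P_def sum_divide_distrib by (rule sum.cong) (simp_all add: sym(2)[of a l] mult.commute)
  have "riemann (cubic_metric T) 0 i j k l = riemann_up (cubic_metric T) l i j k 0"
    by (simp add: riemann_def mat_def if_distrib[of "\<lambda>a. _ * a"] cong: if_cong)
  \<comment> \<open>The derivative terms give half the commutator \<open>P i j - P j i\<close>, and
    the quadratic terms take back a quarter of it.\<close>
  also have "\<dots> = - P j i / 2 + P i j / 2 + (P j i / 4 - P i j / 4)"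
    unfolding riemann_up_def sum_subtractf pd_christoffel_cubic_metric_0[OF assms]
      christoffel_cubic_metric_0[OF assms] 1 2 by simp
  also have "\<dots> = cubic_curvature T i j k l"
    by (simp add: cubic_curvature_def P_def field_simps)
  finally show ?thesis .
qed

subsection \<open>Curvature tensors in dimension three\<close>

text \<open>Pair exchange and the Bianchi identity follow from symmetry of \<open>T\<close> in its
  first two slots, the Bianchi terms cancelling in pairs. This makes \<open>tensor_form_3\<close>
  applicable to \<open>cubic_curvature T\<close>.\<close>

lemma algebraic_curvature_tensor_cubic_curvature:
  assumes "symmetric_cubic T"
  shows "algebraic_curvature_tensor (cubic_curvature T)"
proof -
  have sym: "T i j k = T j i k" for i j k
    using assms unfolding symmetric_cubic_def by blast
  show ?thesis
    unfolding algebraic_curvature_tensor_def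
  proof (intro conjI allI)
    fix i j k l
    show "cubic_curvature T i j k l = - cubic_curvature T j i k l"
      by (simp add: cubic_curvature_def field_simps)
    show "cubic_curvature T i j k l = - cubic_curvature T i j l k"
      by (simp add: cubic_curvature_def mult.commute field_simps)
    show "cubic_curvature T i j k l = cubic_curvature T k l i j"
      by (simp add: cubic_curvature_def sym[of k] sym[of l] mult.commute)
    show "cubic_curvature T i j k l + cubic_curvature T j k i l + cubic_curvature T k i j l = 0"
      by (simp add: cubic_curvature_def sym[of j i] sym[of k i] sym[of k j] field_simps)
  qed
qed

text \<open>The curvature operator on bivectors, in the basis dual to the coordinate axes. The
  cyclic pairs 23, 31, 12 match the signs of the cross product.\<close>

definition curvature_matrix :: "(3 \<Rightarrow> 3 \<Rightarrow> 3 \<Rightarrow> 3 \<Rightarrow> real) \<Rightarrow> real^3^3" where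
  "curvature_matrix R = vector
     [vector [R 2 3 2 3, R 2 3 3 1, R 2 3 1 2],
      vector [R 3 1 2 3, R 3 1 3 1, R 3 1 1 2],
      vector [R 1 2 2 3, R 1 2 3 1, R 1 2 1 2]]"

lemma transpose_curvature_matrix:
  assumes "algebraic_curvature_tensor R"
  shows "transpose (curvature_matrix R) = curvature_matrix R"
proof -
  have "R i j k l = R k l i j" for i j k l
    using assms unfolding algebraic_curvature_tensor_def by blast
  from this[of 2 3 3 1] this[of 2 3 1 2] this[of 3 1 1 2] show ?thesis
    by (simp add: curvature_matrix_def transpose_def vec_eq_iff forall_3)
qed

text \<open>Antisymmetry in each pair means that only the components of the two cross products
  survive. Equality of curvature tensors thereby reduces to equality of 3 by 3 matrices.\<close>

lemma tensor_form_3: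
  assumes "algebraic_curvature_tensor (R :: 3 \<Rightarrow> 3 \<Rightarrow> 3 \<Rightarrow> 3 \<Rightarrow> real)"
  shows "tensor_form R a b c d = (a \<times> b) \<bullet> (curvature_matrix R *v (c \<times> d))"
proof -
  have 1: "R i j k l = - R j i k l" and 2: "R i j k l = - R i j l k" for i j k l
    using assms unfolding algebraic_curvature_tensor_def by metis+
  have 3: "R i i k l = 0" "R i j k k = 0" for i j k l
    using 1[of i i k l] 2[of i j k k] by simp_all
  have 4: "R 2 1 k l = - R 1 2 k l" "R 3 2 k l = - R 2 3 k l" "R 1 3 k l = - R 3 1 k l"
          "R i j 2 1 = - R i j 1 2" "R i j 3 2 = - R i j 2 3" "R i j 1 3 = - R i j 3 1" for i j k l
    by (rule 1 2)+
  have 5: "(\<Sum>k\<in>UNIV. \<Sum>l\<in>UNIV. R i j k l * c $ k * d $ l) =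
     R i j 2 3 * (c \<times> d) $ 1 + R i j 3 1 * (c \<times> d) $ 2 + R i j 1 2 * (c \<times> d) $ 3" for i j
    by (simp add: sum_3 3 4 cross_components algebra_simps)
  have "tensor_form R a b c d =
     (\<Sum>i\<in>UNIV. \<Sum>j\<in>UNIV. (\<Sum>k\<in>UNIV. \<Sum>l\<in>UNIV. R i j k l * c $ k * d $ l) * a $ i * b $ j)"
    unfolding tensor_form_def sum_distrib_right by (simp add: mult_ac)
  also have "\<dots> = (a \<times> b) \<bullet> (curvature_matrix R *v (c \<times> d))"
    unfolding 5
    by (simp add: sum_3 3 4 cross_components[of a b] curvature_matrix_def inner_vec_def
        matrix_vector_mult_def algebra_simps)
  finally show ?thesis .
qed

section \<open>Solving the commutator equations\<close>

lemma quadratic_roots: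
  fixes p c :: real
  assumes "4 * c < p\<^sup>2"
  obtains q r where "q * (p - q) = c" "r * (p - r) = c" "q < p / 2" "p / 2 < r"
proof
  define d where "d = sqrt (p\<^sup>2 - 4 * c)"
  have d: "d\<^sup>2 = p\<^sup>2 - 4 * c" "0 < d"
    using assms by (simp_all add: d_def)
  show "(p - d) / 2 * (p - (p - d) / 2) = c" "(p + d) / 2 * (p - (p + d) / 2) = c"
    using d(1) by (simp_all add: power2_eq_square field_simps)
  show "(p - d) / 2 < p / 2" "p / 2 < (p + d) / 2"
    using d(2) by simp_all
qed

text \<open>
  The commutator equations for T_1, T_2, T_3 the layers of the array M below. For large p the
  roots q < p/2 < r are distinct, so w and s are determined, and u, v absorb the entry S_33
  unless w = s = 0.
\<close>
lemma exists_cubic_parameters: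
  fixes S :: "real^3^3"
  assumes "S$1$3 \<noteq> 0 \<or> S$2$3 \<noteq> 0 \<or> S$1$1 = S$2$2"
  obtains p q r s u v w where
    "r * (p - r) = 4 * S$1$1" "q * (p - q) = 4 * S$2$2"
    "w * (r - q) = 4 * S$1$3" "s * (q - r) = 4 * S$2$3"
    "u * w + s * v - s\<^sup>2 - w\<^sup>2 + q * r = 4 * S$3$3"
proof -
  \<comment> \<open>The value \<open>m\<close> is to be the square of \<open>p\<close>; it exceeds
    \<open>16 * S$1$1\<close> and \<open>16 * S$2$2\<close>, so both quadratics have positive
    discriminant.\<close>
  define m where "m = 16 * (\<bar>S$1$1\<bar> + \<bar>S$2$2\<bar> + 1)"
  define p where "p = sqrt m"
  have "p\<^sup>2 = m"
    by (simp add: p_def m_def)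
  then have large: "4 * (4 * S$1$1) < p\<^sup>2" "4 * (4 * S$2$2) < p\<^sup>2"
    by (simp_all add: m_def)
  obtain r where r: "r * (p - r) = 4 * S$1$1" "p / 2 < r"
    using quadratic_roots[OF large(1)] by metis
  obtain q where q: "q * (p - q) = 4 * S$2$2" "q < p / 2"
    using quadratic_roots[OF large(2)] by metis
  show thesis
  proof (cases "S$1$3 = 0 \<and> S$2$3 = 0")
    case True
    with assms have "S$1$1 = S$2$2" by blast
    \<comment> \<open>Equal diagonal entries allow \<open>q = r\<close>, so the equations for
      \<open>S$1$3\<close> and \<open>S$2$3\<close> hold for any \<open>w\<close> and
      \<open>s\<close>. Taking \<open>w = 1\<close>, \<open>s = 0\<close>, \<open>v = 0\<close> lets
      \<open>u\<close> alone solve the last equation.\<close>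
    with True r(1) show thesis
      by (intro that[of r p r 1 0 "4 * S$3$3 + 1 - r * r" 0]) simp_all
  next
    case False
    define w s where "w = 4 * S$1$3 / (r - q)" and "s = 4 * S$2$3 / (q - r)"
    \<comment> \<open>The ansatz \<open>u = t * w\<close>, \<open>v = t * s\<close> turns
      \<open>u * w + s * v\<close> into \<open>t * (w\<^sup>2 + s\<^sup>2)\<close>; the final 1
      cancels the subtracted squares.\<close>
    define t where "t = (4 * S$3$3 - q * r) / (w\<^sup>2 + s\<^sup>2) + 1"
    have "r - q \<noteq> 0" "q - r \<noteq> 0"
      using q r by simp_all
    moreover from this False have "w\<^sup>2 + s\<^sup>2 \<noteq> 0"
      by (simp add: w_def s_def sum_power2_eq_zero_iff)
    then have "t * (w\<^sup>2 + s\<^sup>2) = 4 * S$3$3 - q * r + (w\<^sup>2 + s\<^sup>2)"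
      by (simp add: t_def field_simps)
    then have "t * w * w + s * (t * s) - s\<^sup>2 - w\<^sup>2 + q * r = 4 * S$3$3"
      by (simp add: power2_eq_square algebra_simps)
    ultimately show thesis
      using q r by (intro that[of r p q w s "t * w" "t * s"]) (simp_all add: w_def s_def)
  qed
qed

text \<open>When \<open>T 3\<close> is diagonal, entry \<open>k\<close>, \<open>l\<close> of its
  commutator with \<open>T j\<close> is \<open>T j k l\<close> times a difference of diagonal
  entries of \<open>T 3\<close>. The zero in position 123 of \<open>T\<close> is what matches
  \<open>S$1$2 = 0\<close>.\<close>

lemma exists_cubic_with_curvature_matrix:
  fixes S :: "real^3^3"
  assumes sym: "transpose S = S"
    and "S$1$2 = 0" "S$1$3 \<noteq> 0 \<or> S$2$3 \<noteq> 0 \<or> S$1$1 = S$2$2"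
  obtains T where "symmetric_cubic T" "curvature_matrix (cubic_curvature T) = S"
proof -
  obtain p q r s u v w where *:
    "r * (p - r) = 4 * S$1$1" "q * (p - q) = 4 * S$2$2"
    "w * (r - q) = 4 * S$1$3" "s * (q - r) = 4 * S$2$3"
    "u * w + s * v - s\<^sup>2 - w\<^sup>2 + q * r = 4 * S$3$3"
    using exists_cubic_parameters[OF assms(3)] by metis
  \<comment> \<open>The third layer is the diagonal matrix with entries \<open>q\<close>,
    \<open>r\<close>, \<open>p\<close>; symmetry then fixes the other layers up to the free entries
    \<open>u\<close>, \<open>s\<close>, \<open>w\<close>, \<open>v\<close>.\<close>
  define M :: "real^3^3^3" where "M = vector
    [vector [vector [u, s, q], vector [s, w, 0], vector [q, 0, 0]],
     vector [vector [s, w, 0], vector [w, v, r], vector [0, r, 0]],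
     vector [vector [q, 0, 0], vector [0, r, 0], vector [0, 0, p]]]"
  define T where "T i j k = M$i$j$k" for i j k
  have "S$i$j = S$j$i" for i j
    using arg_cong[OF sym, of "\<lambda>M. M$i$j"] by (simp add: transpose_def)
  from this[of 2 1] this[of 3 1] this[of 3 2]
  have S: "S$2$1 = 0" "S$3$1 = S$1$3" "S$3$2 = S$2$3"
    using assms(2) by simp_all
  have "symmetric_cubic T"
    by (simp add: symmetric_cubic_def T_def M_def forall_3)
  moreover have "curvature_matrix (cubic_curvature T) = S"
    using * assms(2) S
    by (simp add: curvature_matrix_def vec_eq_iff forall_3 cubic_curvature_def sum_3 T_def M_def
        power2_eq_square algebra_simps)
  ultimately show thesis
    by (rule that)
qed

section \<open>Rotating the curvature matrix to a solvable form\<close>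

lemma rotation_matrix_mult:
  "rotation_matrix A \<Longrightarrow> rotation_matrix B \<Longrightarrow> rotation_matrix (A ** B)"
  for A B :: "real^'n^'n"
  by (simp add: rotation_matrix_def orthogonal_matrix_mul det_mul)

text \<open>Along the unit circle the form takes the values \<open>a\<close> at angle 0 and
  \<open>-a\<close> at a right angle, so it vanishes in between.\<close>

lemma exists_unit_vector_annihilating_quadratic:
  fixes a b :: real
  obtains c s where "c\<^sup>2 + s\<^sup>2 = 1" "a * (c\<^sup>2 - s\<^sup>2) + b * (c * s) = 0"
proof -
  define f where "f t = a * ((cos t)\<^sup>2 - (sin t)\<^sup>2) + b * (cos t * sin t)" for t
  have cont: "isCont f t" for t
    unfolding f_def by (intro continuous_intros)
  have "\<exists>t. f t = 0"
  proof (cases "a \<le> 0")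
    case True
    then show ?thesis
      using IVT[of f 0 0 "pi/2"] cont by (auto simp: f_def)
  next
    case False
    then show ?thesis
      using IVT2[of f "pi/2" 0 0] cont by (auto simp: f_def)
  qed
  then show thesis
    using that[of "cos t" "sin t" for t] by (auto simp: f_def)
qed

definition admissible :: "real^3^3 \<Rightarrow> bool" where
  "admissible S \<longleftrightarrow> S$1$2 = 0 \<and> (S$1$3 \<noteq> 0 \<or> S$2$3 \<noteq> 0 \<or> S$1$1 = S$2$2)"

lemma exists_rotation_entry_12_eq_0:
  fixes S :: "real^3^3"
  assumes "transpose S = S"
  obtains A where "rotation_matrix A" "(transpose A ** S ** A)$1$2 = 0"
proof -
  obtain c s where cs: "c\<^sup>2 + s\<^sup>2 = 1" "S$1$2 * (c\<^sup>2 - s\<^sup>2) + (S$2$2 - S$1$1) * (c * s) = 0"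
    by (rule exists_unit_vector_annihilating_quadratic)
  define A :: "real^3^3" where
    "A = vector [vector [c, -s, 0], vector [s, c, 0], vector [0, 0, 1]]"
  have "rotation_matrix A"
    using cs(1)
    by (simp add: rotation_matrix_def orthogonal_matrix_def A_def det_3 matrix_matrix_mult_def
        transpose_def mat_def vec_eq_iff forall_3 sum_3 power2_eq_square algebra_simps)
  moreover have "S$2$1 = S$1$2"
    using arg_cong[OF assms, of "\<lambda>M. M$1$2"] by (simp add: transpose_def)
  then have "(transpose A ** S ** A)$1$2 = 0"
    using cs(2)
    by (simp add: A_def matrix_matrix_mult_def transpose_def sum_3 power2_eq_square algebra_simps)
  ultimately show thesis
    by (rule that)
qed

text \<open>If the first two diagonal entries differ, one of them differs from the third. Turning
  that axis and the third through 45 degrees creates an off-diagonal entry equal to half their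
  difference and leaves the 12 entry zero.\<close>

lemma exists_rotation_admissible_diagonal:
  fixes S :: "real^3^3"
  assumes "transpose S = S" "S$1$2 = 0" "S$1$3 = 0" "S$2$3 = 0"
  obtains A where "rotation_matrix A" "admissible (transpose A ** S ** A)"
proof -
  define h where "h = sqrt (1/2)"
  have h: "h * h = 1/2"
    by (simp add: h_def)
  then have h': "h * (h * x) = x / 2" for x
    by (simp flip: mult.assoc)
  have "S$i$j = S$j$i" for i j
    using arg_cong[OF assms(1), of "\<lambda>M. M$i$j"] by (simp add: transpose_def)
  from this[of 2 1] this[of 3 1] this[of 3 2]
  have S: "S$2$1 = 0" "S$3$1 = 0" "S$3$2 = 0"
    using assms(2-4) by simp_all
  define A B :: "real^3^3" where
    "A = vector [vector [1, 0, 0], vector [0, h, -h], vector [0, h, h]]" and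
    "B = vector [vector [h, 0, -h], vector [0, 1, 0], vector [h, 0, h]]"
  have A: "rotation_matrix A" and B: "rotation_matrix B"
    by (simp_all add: rotation_matrix_def orthogonal_matrix_def A_def B_def det_3
        matrix_matrix_mult_def transpose_def mat_def vec_eq_iff forall_3 sum_3 h)
  consider "S$1$1 = S$2$2" | "S$2$2 \<noteq> S$3$3" | "S$1$1 \<noteq> S$3$3"
    by argo
  then show thesis
  proof cases
    case 1
    have "rotation_matrix (mat 1 :: real^3^3)"
      by (simp add: rotation_matrix_def orthogonal_matrix_id)
    then show thesis
      by (rule that) (use 1 assms(2) in \<open>simp add: admissible_def transpose_mat\<close>)
  next
    case 2
    then have "admissible (transpose A ** S ** A)"
      using assms(2-4) S
      by (simp add: admissible_def A_def matrix_matrix_mult_def transpose_def sum_3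
          algebra_simps h')
    with A show thesis by (rule that)
  next
    case 3
    then have "admissible (transpose B ** S ** B)"
      using assms(2-4) S
      by (simp add: admissible_def B_def matrix_matrix_mult_def transpose_def sum_3
          algebra_simps h')
    with B show thesis by (rule that)
  qed
qed

lemma exists_rotation_admissible:
  fixes S :: "real^3^3"
  assumes "transpose S = S"
  obtains A where "rotation_matrix A" "admissible (transpose A ** S ** A)"
proof -
  obtain A where A: "rotation_matrix A" "(transpose A ** S ** A)$1$2 = 0"
    using exists_rotation_entry_12_eq_0[OF assms] .
  define S' where "S' = transpose A ** S ** A"
  have S': "transpose S' = S'"
    using assms by (simp add: S'_def matrix_transpose_mul matrix_mul_assoc)
  show thesis
  proof (cases "admissible S'")
    case True
    with A(1) show thesis
      unfolding S'_def by (rule that)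
  next
    case False
    \<comment> \<open>With the 12 entry already zero, failing to be admissible forces the other
      off-diagonal entries to vanish, so the diagonal case applies.\<close>
    then have "S'$1$3 = 0" "S'$2$3 = 0"
      using A(2) by (auto simp: admissible_def S'_def)
    then obtain B where B: "rotation_matrix B" "admissible (transpose B ** S' ** B)"
      using exists_rotation_admissible_diagonal[OF S'] A(2) by (metis S'_def)
    moreover have "transpose B ** S' ** B = transpose (A ** B) ** S ** (A ** B)"
      by (simp add: S'_def matrix_transpose_mul matrix_mul_assoc)
    ultimately show thesis
      using that[of "A ** B"] A(1) by (simp add: rotation_matrix_mult)
  qed
qed

section \<open>From the rotated matrix back to the curvature tensor\<close>

lemma inner_matrix_vector_mult_left: "(A *v x) \<bullet> y = x \<bullet> (transpose A *v y)"
  for A :: "real^'n^'m"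
  using dot_lmul_matrix[of x "transpose A" y] by simp

text \<open>Rotations commute with the cross product, determinant 1 fixing the sign, so rotating all
  four arguments conjugates the curvature matrix by \<open>A\<close>.\<close>

lemma exists_rotation_cubic:
  fixes R :: "3 \<Rightarrow> 3 \<Rightarrow> 3 \<Rightarrow> 3 \<Rightarrow> real"
  assumes "algebraic_curvature_tensor R"
  obtains A :: "real^3^3" and T where "rotation_matrix A" "symmetric_cubic T"
    "\<And>a b c d. tensor_form R (A *v a) (A *v b) (A *v c) (A *v d)
       = tensor_form (cubic_curvature T) a b c d"
proof -
  define S where "S = curvature_matrix R"
  have S: "transpose S = S"
    unfolding S_def by (rule transpose_curvature_matrix[OF assms])
  obtain A where A: "rotation_matrix A" "admissible (transpose A ** S ** A)"
    using exists_rotation_admissible[OF S] .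
  have "transpose (transpose A ** S ** A) = transpose A ** S ** A"
    using S by (simp add: matrix_transpose_mul matrix_mul_assoc)
  then obtain T where T: "symmetric_cubic T"
    "curvature_matrix (cubic_curvature T) = transpose A ** S ** A"
    using exists_cubic_with_curvature_matrix A(2) unfolding admissible_def by blast
  have "tensor_form R (A *v a) (A *v b) (A *v c) (A *v d)
      = tensor_form (cubic_curvature T) a b c d" for a b c d
  proof -
    have "tensor_form R (A *v a) (A *v b) (A *v c) (A *v d) =
        (A *v (a \<times> b)) \<bullet> (S *v (A *v (c \<times> d)))"
      by (simp add: tensor_form_3[OF assms] S_def cross_rotation_matrix[OF A(1)])
    also have "\<dots> = (a \<times> b) \<bullet> ((transpose A ** S ** A) *v (c \<times> d))"
      by (simp only: inner_matrix_vector_mult_left matrix_vector_mul_assoc matrix_mul_assoc)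
    also have "\<dots> = tensor_form (cubic_curvature T) a b c d"
      by (simp add: tensor_form_3[OF algebraic_curvature_tensor_cubic_curvature[OF T(1)]] T(2))
    finally show ?thesis .
  qed
  with A(1) T(1) show thesis
    by (rule that)
qed

theorem mainTheorem5:
  fixes R :: "3 \<Rightarrow> 3 \<Rightarrow> 3 \<Rightarrow> 3 \<Rightarrow> real"
  assumes "algebraic_curvature_tensor R"
  shows "\<exists>(U :: (real^3) set) (g :: real^3 \<Rightarrow> real^3^3) p (A :: real^3^3).
           hessian_metric_on U g \<and> p \<in> U \<and>
           invertible A \<and>
           (\<forall>v w. (A *v v) \<bullet> (A *v w) = v \<bullet> (g p *v w)) \<and>
           (\<forall>a b c d. tensor_form R (A *v a) (A *v b) (A *v c) (A *v d)
                       = tensor_form (riemann g p) a b c d)"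
proof -
  obtain A :: "real^3^3" and T where A: "rotation_matrix A" and T: "symmetric_cubic T"
    and form: "\<And>a b c d. tensor_form R (A *v a) (A *v b) (A *v c) (A *v d)
       = tensor_form (cubic_curvature T) a b c d"
    by (rule exists_rotation_cubic[OF assms]) blast
  have orth: "orthogonal_matrix A"
    using A by (simp add: rotation_matrix_def)
  have "0 \<in> cubic_ball T"
    by (simp add: cubic_ball_def add_pos_nonneg sum_nonneg)
  moreover have "invertible A"
    using A by (simp add: invertible_det_nz rotation_matrix_def)
  \<comment> \<open>The chosen point is the origin, where the metric is the identity, so being an
    isometry means that \<open>A\<close> is orthogonal.\<close>
  moreover have "(A *v v) \<bullet> (A *v w) = v \<bullet> (cubic_metric T 0 *v w)" for v w
    using orth by (simp only: inner_matrix_vector_mult_left matrix_vector_mul_assoc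
        orthogonal_matrix cubic_metric_0)
  moreover have "tensor_form R (A *v a) (A *v b) (A *v c) (A *v d)
      = tensor_form (riemann (cubic_metric T) 0) a b c d" for a b c d
    unfolding form by (simp add: tensor_form_def riemann_cubic_metric_0[OF T])
  ultimately show ?thesis
    using hessian_metric_on_cubic_metric[OF T] by blast
qed

end
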